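(* Let $a,b,c,d\in\mathbb R$ be admissible parameters (see context) with $c\neq0$, let $\lambda>0$, $\sigma\ne 0$, $m\in(0,1]$, and let $\varepsilon\in\{1,-1\}$. Assume $8ac+\sigma^2(b-2d)^2>0$ and put $$S=\sqrt{8ac+\sigma^2(b-2d)^2}.$$ Define $j_1=k_1=0$, $$j_2=\frac{3\lambda^2m^2}{2c}\Big(4ac+b\sigma^2(b-2d)+\varepsilon b\sigma S\Big),\qquad k_2=3\lambda^2m^2\big(\sigma(b+2d)+\varepsilon S\big),$$ $$\begin{aligned}k_0=\frac{1}{2c\,(\sigma(b+2d)+\varepsilon S)}\Big(&-8b^2c\lambda^2m^2\sigma^2-32cd^2\lambda^2m^2\sigma^2-32ac^2\lambda^2m^2+4b^2c\lambda^2\sigma^2+16cd^2\lambda^2\sigma^2\\&+16a\lambda^2c^2-b^2\sigma^2+2bc\sigma^2+2bd\sigma^2+4cd\sigma^2-4ac\\&-\varepsilon\sigma S\,\big(8bc\lambda^2m^2+16cd\lambda^2m^2-4bc\lambda^2-8cd\lambda^2+b-2c\big)\Big),\end{aligned}$$ $$\begin{aligned}j_0=\frac{1}{4c^2\big(4ac+\sigma^2(b^2+4d^2)+\varepsilon\sigma(b+2d)S\big)}\Big(&-8b^4c\lambda^2m^2\sigma^4+16b^3cd\lambda^2m^2\sigma^4-64ab^2c^2\lambda^2m^2\sigma^2-32abc^2d\lambda^2m^2\sigma^2\\&-64ac^2d^2\lambda^2m^2\sigma^2+4b^4c\lambda^2\sigma^4-8b^3cd\lambda^2\sigma^4-64a^2c^3\lambda^2m^2+32ab^2c^2\lambda^2\sigma^2\\&+16abc^2d\lambda^2\sigma^2+32ac^2d^2\lambda^2\sigma^2+b^4\sigma^4-4b^3d\sigma^4+4b^2d^2\sigma^4+32a^2c^3\lambda^2\\&+8ab^2c\sigma^2-8abcd\sigma^2-4b^2c^2\sigma^2-16c^2d^2\sigma^2+8a^2c^2-16ac^3\\&-\varepsilon\sigma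 S\,\big(8b^3c\lambda^2m^2\sigma^2+32abc^2\lambda^2m^2+32ac^2d\lambda^2m^2-4b^3c\lambda^2\sigma^2-16abc^2\lambda^2\\&\qquad-16ac^2d\lambda^2-b^3\sigma^2+2b^2d\sigma^2-4abc+4bc^2+8c^2d\big)\Big).\end{aligned}$$ Then, with $\xi=x-\sigma t$, the functions $$\eta=j_0+j_1\,\mathrm{cn}(\lambda\xi,m)+j_2\,\mathrm{cn}^2(\lambda\xi,m),\qquad w=k_0+k_1\,\mathrm{cn}(\lambda\xi,m)+k_2\,\mathrm{cn}^2(\lambda\xi,m)$$ (so that, since $j_1=k_1=0$, only the constant and $\mathrm{cn}^2$ terms appear) form a traveling-wave solution of the $abcd$-system.
   Context: The $abcd$-system for real-valued $\eta(x,t),w(x,t)$, $x,t\in\mathbb R$, is $$\eta_t+w_x+(w\eta)_x+a w_{xxx}-b\eta_{xxt}=0,\qquad w_t+\eta_x+ww_x+c\,\eta_{xxx}-d w_{xxt}=0 .$$ The real parameters $a,b,c,d$ are admissible if for some $\theta\in[0,1]$: $a+b=\tfrac12(\theta^2-\tfrac13)$, $c+d=\tfrac12(1-\theta^2)\ge 0$, and $a+b+c+d=\tfrac13$. A traveling-wave solution is one in which $\eta$ and $w$ depend on $(x,t)$ only through $\xi=x-\sigma t$, where $\sigma$ is the wave speed. Jacobi elliptic function convention: for $0\le m\le 1$, with $v=\int_0^\phi (1-m^2\sin^2 t)^{-1/2}dt$, one sets $\mathrm{cn}(v,m)=\cos\phi$; $m$ is the elliptic modulus (so $\mathrm{cn}(v,1)=\mathrm{sech}\,v$).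 *)

theory Defs
  imports "HOL-Analysis.Analysis"
begin

definition admissible :: "real \<Rightarrow> real \<Rightarrow> real \<Rightarrow> real \<Rightarrow> bool" where
  "admissible a b c d \<longleftrightarrow>
     (\<exists>\<theta>\<in>{0..1}. a + b = 1/2 * (\<theta>\<^sup>2 - 1/3) \<and> c + d = 1/2 * (1 - \<theta>\<^sup>2) \<and>
        c + d \<ge> 0 \<and> a + b + c + d = 1/3)"

(* The interval integral is oriented: for \<phi> < 0 it is minus the integral over [\<phi>, 0]. *)
definition ellF :: "real \<Rightarrow> real \<Rightarrow> real" where
  "ellF \<phi> m = (LBINT t=0..\<phi>. 1 / sqrt (1 - m\<^sup>2 * (sin t)\<^sup>2))"

(* m is the modulus, not the parameter m^2. For m = 1 the integral diverges as soon as
   \<bar>\<phi>\<bar> reaches pi/2, and the library assigns 0 to a divergent integral; the side condition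
   restricts the amplitude \<phi> to the range on which the integral converges. *)
definition jacobi_cn :: "real \<Rightarrow> real \<Rightarrow> real" where
  "jacobi_cn v m = cos (THE \<phi>. (m = 1 \<longrightarrow> \<bar>\<phi>\<bar> < pi / 2) \<and> v = ellF \<phi> m)"

text \<open>Functions of \<open>(x, t)\<close> are curried, the space variable coming first.\<close>

definition pdx :: "(real \<Rightarrow> real \<Rightarrow> real) \<Rightarrow> real \<Rightarrow> real \<Rightarrow> real" where
  "pdx u = (\<lambda>x t. deriv (\<lambda>y. u y t) x)"

definition pdt :: "(real \<Rightarrow> real \<Rightarrow> real) \<Rightarrow> real \<Rightarrow> real \<Rightarrow> real" where
  "pdt u = (\<lambda>x t. deriv (\<lambda>s. u x s) t)"

(* Functions of class C^n on the plane. The differentiability clauses are needed because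
   deriv is a total operator with unspecified values at points of non-differentiability. *)
fun C_class :: "nat \<Rightarrow> (real \<Rightarrow> real \<Rightarrow> real) \<Rightarrow> bool" where
  "C_class 0 u \<longleftrightarrow> continuous_on UNIV (\<lambda>p. u (fst p) (snd p))"
| "C_class (Suc n) u \<longleftrightarrow>
     continuous_on UNIV (\<lambda>p. u (fst p) (snd p)) \<and>
     (\<forall>x t. (\<lambda>y. u y t) differentiable (at x)) \<and>
     (\<forall>x t. (\<lambda>s. u x s) differentiable (at t)) \<and>
     C_class n (pdx u) \<and> C_class n (pdt u)"

text \<open>Classical solutions on the whole plane; the equations have order three.\<close>

definition abcd_solution ::
  "real \<Rightarrow> real \<Rightarrow> real \<Rightarrow> real \<Rightarrow> (real \<Rightarrow> real \<Rightarrow> real) \<Rightarrow> (real \<Rightarrow> real \<Rightarrow> real) \<Rightarrow> bool" where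
  "abcd_solution a b c d \<eta> w \<longleftrightarrow>
     C_class 3 \<eta> \<and> C_class 3 w \<and>
     (\<forall>x t. pdt \<eta> x t + pdx w x t + pdx (\<lambda>x t. w x t * \<eta> x t) x t
              + a * pdx (pdx (pdx w)) x t - b * pdt (pdx (pdx \<eta>)) x t = 0) \<and>
     (\<forall>x t. pdt w x t + pdx \<eta> x t + w x t * pdx w x t
              + c * pdx (pdx (pdx \<eta>)) x t - d * pdt (pdx (pdx w)) x t = 0)"

definition traveling_wave_solution ::
  "real \<Rightarrow> real \<Rightarrow> real \<Rightarrow> real \<Rightarrow> real \<Rightarrow> (real \<Rightarrow> real \<Rightarrow> real) \<Rightarrow> (real \<Rightarrow> real \<Rightarrow> real) \<Rightarrow> bool" where
  "traveling_wave_solution a b c d \<sigma> \<eta> w \<longleftrightarrow>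
     abcd_solution a b c d \<eta> w \<and>
     (\<exists>f g. (\<forall>x t. \<eta> x t = f (x - \<sigma> * t)) \<and> (\<forall>x t. w x t = g (x - \<sigma> * t)))"

end

theory Submission
  imports Defs
begin

text \<open>
  With \<open>u = cn\<^sup>2(\<lambda>\<xi>, m)\<close> one has \<open>u''' = 4 \<lambda>\<^sup>2 (2 m\<^sup>2 - 1 - 3 m\<^sup>2 u) u'\<close>, so for affine functions of \<open>u\<close>
  each of the two equations becomes \<open>u'\<close> times an affine function of \<open>u\<close>, and the system reduces
  to four algebraic equations for \<open>j\<^sub>0, j\<^sub>2, k\<^sub>0, k\<^sub>2\<close>. In terms of \<open>p = \<sigma>(b + 2 d) + \<epsilon> S\<close> and
  \<open>q = (p - 4 d \<sigma>) / (4 c)\<close> their solution is \<open>k\<^sub>2 = 3 \<lambda>\<^sup>2 m\<^sup>2 p\<close>, \<open>j\<^sub>2 = q k\<^sub>2\<close>,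
  \<open>k\<^sub>0 = \<sigma> - q - \<lambda>\<^sup>2 (2 m\<^sup>2 - 1) p\<close>, \<open>j\<^sub>0 = q\<^sup>2 - 1 - \<lambda>\<^sup>2 (2 m\<^sup>2 - 1) p q\<close>, while the definition of \<open>S\<close>
  says \<open>2 a = q (p - 2 b \<sigma>)\<close>. The denominators of \<open>k\<^sub>0\<close> and \<open>j\<^sub>0\<close> are \<open>2 c p\<close> and \<open>2 c\<^sup>2 p\<^sup>2\<close>;
  if \<open>p = 0\<close>, then \<open>j\<^sub>2 = k\<^sub>2 = 0\<close> and the functions are constant, whatever values division by
  zero assigns to \<open>k\<^sub>0\<close> and \<open>j\<^sub>0\<close>.
\<close>

section \<open>The Jacobi amplitude\<close>

text \<open>At modulus 1 the radicand is \<open>(cos t)\<^sup>2\<close>, and on the open interval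
  between \<open>-pi/2\<close> and \<open>pi/2\<close> the integrand is the secant, with
  antiderivative \<open>arsinh (tan t)\<close>, the inverse of the Gudermannian function.\<close>

lemma ellF_1:
  assumes "\<bar>\<phi>\<bar> < pi/2"
  shows "ellF \<phi> 1 = arsinh (tan \<phi>)"
proof -
  have cp: "cos t > 0" if "min 0 \<phi> \<le> t" "t \<le> max 0 \<phi>" for t
    using that assms by (intro cos_gt_zero_pi) (auto simp: min_def max_def split: if_splits)
  have sq: "sqrt (1 - (sin t)\<^sup>2) = cos t" if "cos t > 0" for t :: real
    using that by (simp add: cos_squared_eq[symmetric])
  have "(LBINT t=0..\<phi>. 1 / sqrt (1 - 1\<^sup>2 * (sin t)\<^sup>2)) = arsinh (tan \<phi>) - arsinh (tan 0)"
    unfolding zero_ereal_def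
  proof (rule interval_integral_FTC_finite)
    have "1 - (sin t)\<^sup>2 \<noteq> 0" if "min 0 \<phi> \<le> t" "t \<le> max 0 \<phi>" for t
      using cp[OF that] by (simp add: cos_squared_eq[symmetric])
    then show "continuous_on {min 0 \<phi>..max 0 \<phi>} (\<lambda>t. 1 / sqrt (1 - 1\<^sup>2 * (sin t)\<^sup>2))"
      by (intro continuous_intros) auto
  next
    fix t assume t: "min 0 \<phi> \<le> t" "t \<le> max 0 \<phi>"
    have c: "cos t > 0" using cp[OF t] .
    have "1 + (tan t)\<^sup>2 = (1 / cos t)\<^sup>2"
      using c by (simp add: tan_def field_simps)
    then have r: "sqrt ((tan t)\<^sup>2 + 1) = 1 / cos t"
      using c by (simp add: add.commute real_sqrt_divide)
    have "((\<lambda>t. arsinh (tan t)) has_real_derivative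
            1 / sqrt ((tan t)\<^sup>2 + 1) * inverse ((cos t)\<^sup>2)) (at t)"
      using c by (intro DERIV_chain2[OF arsinh_real_has_field_derivative] DERIV_tan) auto
    also have "1 / sqrt ((tan t)\<^sup>2 + 1) * inverse ((cos t)\<^sup>2) = 1 / sqrt (1 - 1\<^sup>2 * (sin t)\<^sup>2)"
      using c sq[OF c] unfolding r by (simp add: field_simps power2_eq_square)
    finally show "((\<lambda>t. arsinh (tan t)) has_vector_derivative 1 / sqrt (1 - 1\<^sup>2 * (sin t)\<^sup>2))
                    (at t within {min 0 \<phi>..max 0 \<phi>})"
      by (simp add: has_real_derivative_iff_has_vector_derivative has_vector_derivative_at_within)
  qed
  then show ?thesis by (simp add: ellF_def)
qed

lemma elliptic_radicand_pos:
  fixes m t :: real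
  assumes "0 < m" "m < 1"
  shows "1 - m\<^sup>2 * (sin t)\<^sup>2 > 0"
proof -
  have "m\<^sup>2 * (sin t)\<^sup>2 \<le> m\<^sup>2 * 1"
    by (intro mult_left_mono) (simp_all add: abs_square_le_1)
  also have "\<dots> < 1" using assms by (simp add: power_less_one_iff)
  finally show ?thesis by simp
qed

lemma ellF_has_derivative:
  assumes "0 < m" "m < 1"
  shows "((\<lambda>\<phi>. ellF \<phi> m) has_real_derivative 1 / sqrt (1 - m\<^sup>2 * (sin \<phi>)\<^sup>2)) (at \<phi>)"
proof -
  \<comment> \<open>With this radius both 0 and \<open>\<phi>\<close> are interior to
    \<open>{-r..r}\<close>, so the derivative within the interval is a two-sided one.\<close>
  define r where "r = \<bar>\<phi>\<bar> + 1"
  have "((\<lambda>u. LBINT t=ereal 0..ereal u. 1 / sqrt (1 - m\<^sup>2 * (sin t)\<^sup>2)) has_vector_derivative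
          1 / sqrt (1 - m\<^sup>2 * (sin \<phi>)\<^sup>2)) (at \<phi> within {-r..r})"
  proof (rule interval_integral_FTC2)
    show "continuous_on {-r..r} (\<lambda>t. 1 / sqrt (1 - m\<^sup>2 * (sin t)\<^sup>2))"
      using elliptic_radicand_pos[OF assms] by (intro continuous_intros) (metis less_irrefl real_sqrt_eq_zero_cancel_iff)
  qed (auto simp: r_def)
  moreover have "at \<phi> within {-r..r} = at \<phi>"
    by (rule at_within_interior) (auto simp: r_def)
  ultimately show ?thesis
    by (simp add: ellF_def has_real_derivative_iff_has_vector_derivative zero_ereal_def)
qed

text \<open>The amplitude \<open>A\<close> inverts \<open>ellF\<close>, so its derivative is the
  reciprocal of the integrand. For \<open>m = 1\<close>, where the integral diverges at
  \<open>pi/2\<close>, it is the explicit Gudermannian function; for \<open>m < 1\<close> the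
  integrand is at least 1, which makes \<open>ellF\<close> a bijection of the line. Strict
  positivity of the radicand is recorded because its square root is differentiated once more
  later.\<close>

lemma amplitude_exists:
  assumes "0 < m" "m \<le> 1"
  shows "\<exists>A. \<forall>v. jacobi_cn v m = cos (A v) \<and> 1 - m\<^sup>2 * (sin (A v))\<^sup>2 > 0 \<and>
           (A has_real_derivative sqrt (1 - m\<^sup>2 * (sin (A v))\<^sup>2)) (at v)"
proof (cases "m = 1")
  case True
  define A where "A v = arctan (sinh v)" for v :: real
  have A_bound: "\<bar>A v\<bar> < pi/2" for v
    using arctan_bounded[of "sinh v"] by (auto simp: A_def abs_less_iff)
  have the: "(THE \<phi>. (m = 1 \<longrightarrow> \<bar>\<phi>\<bar> < pi / 2) \<and> v = ellF \<phi> m) = A v" for v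
  proof (rule the_equality)
    show "(m = 1 \<longrightarrow> \<bar>A v\<bar> < pi / 2) \<and> v = ellF (A v) m"
      using A_bound[of v] by (simp add: True ellF_1) (simp add: A_def tan_arctan arsinh_sinh_real)
  next
    fix \<phi> assume "(m = 1 \<longrightarrow> \<bar>\<phi>\<bar> < pi / 2) \<and> v = ellF \<phi> m"
    then have "\<bar>\<phi>\<bar> < pi/2" "v = arsinh (tan \<phi>)" by (auto simp: True ellF_1)
    then show "\<phi> = A v"
      by (simp add: A_def arctan_tan abs_less_iff)
  qed
  have ch: "1 + (sinh v)\<^sup>2 = (cosh v)\<^sup>2" for v :: real
    by (simp add: cosh_square_eq)
  have c: "cos (A v) = 1 / cosh v" for v
    by (simp add: A_def cos_arctan ch)
  have cs: "1 - m\<^sup>2 * (sin (A v))\<^sup>2 = (cos (A v))\<^sup>2" for v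
    by (simp add: True cos_squared_eq)
  have "(A has_real_derivative sqrt (1 - m\<^sup>2 * (sin (A v))\<^sup>2)) (at v)" for v
  proof -
    have "(A has_real_derivative inverse (1 + (sinh v)\<^sup>2) * cosh v) (at v)"
      unfolding A_def[abs_def]
      by (rule DERIV_chain2[OF DERIV_arctan]) (auto intro!: derivative_eq_intros)
    also have "inverse (1 + (sinh v)\<^sup>2) * cosh v = 1 / cosh v"
      unfolding ch by (simp add: field_simps power2_eq_square)
    also have "\<dots> = sqrt (1 - m\<^sup>2 * (sin (A v))\<^sup>2)"
      by (simp add: cs c real_sqrt_divide)
    finally show ?thesis .
  qed
  moreover have "1 - m\<^sup>2 * (sin (A v))\<^sup>2 > 0" for v
    unfolding cs c by simp
  moreover have "jacobi_cn v m = cos (A v)" for v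
    unfolding jacobi_cn_def the ..
  ultimately show ?thesis by (intro exI[of _ A]) simp
next
  case False
  then have m: "0 < m" "m < 1" using assms by auto
  note pos = elliptic_radicand_pos[OF m]
  define F where "F \<phi> = ellF \<phi> m" for \<phi>
  have der: "(F has_real_derivative 1 / sqrt (1 - m\<^sup>2 * (sin \<phi>)\<^sup>2)) (at \<phi>)" for \<phi>
    using ellF_has_derivative[OF m] by (simp add: F_def[abs_def])
  have cont: "isCont F \<phi>" for \<phi> using der DERIV_isCont by blast
  have F0: "F 0 = 0" by (simp add: F_def ellF_def flip: zero_ereal_def)
  have ge1: "1 / sqrt (1 - m\<^sup>2 * (sin \<phi>)\<^sup>2) \<ge> 1" for \<phi>
    using pos[of \<phi>] by simp
  \<comment> \<open>Growth at least as fast as the identity serves twice: it gives injectivity, and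
    it gives the bounds at \<open>\<bar>v\<bar>\<close> and \<open>-\<bar>v\<bar>\<close> for the
    intermediate value theorem.\<close>
  have expand: "F y - F x \<ge> y - x" if "x \<le> y" for x y
  proof -
    have "F x - x \<le> F y - y"
    proof (rule DERIV_nonneg_imp_nondecreasing[OF that])
      fix t
      show "\<exists>z. ((\<lambda>t. F t - t) has_real_derivative z) (at t) \<and> 0 \<le> z"
        using ge1[of t] by (intro exI[of _ "1 / sqrt (1 - m\<^sup>2 * (sin t)\<^sup>2) - 1"])
          (auto intro!: derivative_eq_intros der)
    qed
    then show ?thesis by simp
  qed
  have inj: "x = y" if "F x = F y" for x y
  proof (cases "x \<le> y")
    case True
    with expand[OF True] that show ?thesis by linarith
  next
    case False
    then have "y \<le> x" by simp
    with expand[OF this] that show ?thesis by linarith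
  qed
  have surj: "\<exists>\<phi>. F \<phi> = v" for v
  proof -
    have "F (-\<bar>v\<bar>) \<le> v" "v \<le> F \<bar>v\<bar>"
      using expand[of 0 "\<bar>v\<bar>"] expand[of "-\<bar>v\<bar>" 0] F0 by linarith+
    then have "\<exists>\<phi>\<ge>-\<bar>v\<bar>. \<phi> \<le> \<bar>v\<bar> \<and> F \<phi> = v"
      using cont by (intro IVT) auto
    then show ?thesis by blast
  qed
  define A where "A v = (THE \<phi>. v = F \<phi>)" for v
  have FA: "F (A v) = v" for v
  proof -
    obtain \<phi> where \<phi>: "F \<phi> = v" using surj by blast
    then have "A v = \<phi>" unfolding A_def by (intro the_equality) (auto intro: inj)
    with \<phi> show ?thesis by simp
  qed
  have AF: "A (F \<phi>) = \<phi>" for \<phi>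
    by (rule inj) (rule FA)
  have cn: "jacobi_cn v m = cos (A v)" for v
    using False by (simp add: jacobi_cn_def A_def F_def)
  \<comment> \<open>The derivative rule for inverse functions asks for continuity of the inverse.
    The radius 1 here and the interval from \<open>v - 1\<close> to \<open>v + 1\<close> below are
    arbitrary, since \<open>AF\<close> and \<open>FA\<close> hold everywhere.\<close>
  have contA: "isCont A v" for v
  proof -
    have "isCont A (F (A v))"
      by (rule isCont_inverse_function[of 1]) (simp_all add: AF cont)
    then show ?thesis by (simp only: FA)
  qed
  have "(A has_real_derivative sqrt (1 - m\<^sup>2 * (sin (A v))\<^sup>2)) (at v)" for v
  proof -
    have "(A has_real_derivative inverse (1 / sqrt (1 - m\<^sup>2 * (sin (A v))\<^sup>2))) (at v)"
      by (rule DERIV_inverse_function[OF der, of _ _ "v - 1" "v + 1"])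
         (use pos[of "A v"] FA contA in auto)
    then show ?thesis by simp
  qed
  with cn pos show ?thesis by blast
qed

text \<open>For \<open>u = cn\<^sup>2\<close> one has \<open>u' = -2 sn cn dn\<close>, hence
  \<open>u'\<^sup>2 = 4 u (1 - u) (1 - m\<^sup>2 + m\<^sup>2 u)\<close>, and \<open>u''\<close> is a
  quadratic polynomial in \<open>u\<close>. The first derivative \<open>p\<close> can stay abstract:
  its own derivative is all that has to be known about it.\<close>

lemma jacobi_cn_square_derivatives:
  assumes "0 < m" "m \<le> 1"
  obtains p where
    "\<And>v. ((\<lambda>v. (jacobi_cn v m)\<^sup>2) has_real_derivative p v) (at v)"
    "\<And>v. (p has_real_derivative
        2 * (1 - m\<^sup>2 + 2 * (2 * m\<^sup>2 - 1) * (jacobi_cn v m)\<^sup>2 - 3 * m\<^sup>2 * ((jacobi_cn v m)\<^sup>2)\<^sup>2)) (at v)"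
proof -
  from amplitude_exists[OF assms] obtain A where
    cn: "\<And>v. jacobi_cn v m = cos (A v)" and
    pos: "\<And>v. 1 - m\<^sup>2 * (sin (A v))\<^sup>2 > 0" and
    A: "\<And>v. (A has_real_derivative sqrt (1 - m\<^sup>2 * (sin (A v))\<^sup>2)) (at v)"
    by blast
  \<comment> \<open>This is the Jacobi function dn, with derivative
    \<open>- m\<^sup>2 sn cn\<close>.\<close>
  define D where "D v = sqrt (1 - m\<^sup>2 * (sin (A v))\<^sup>2)" for v
  have D_sq: "(D v)\<^sup>2 = 1 - m\<^sup>2 * (sin (A v))\<^sup>2" and D_pos: "D v > 0" for v
    using pos[of v] by (auto simp: D_def)
  have A': "(A has_real_derivative D v) (at v)" for v
    using A by (simp add: D_def)
  have D': "(D has_real_derivative - m\<^sup>2 * sin (A v) * cos (A v)) (at v)" for v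
  proof -
    have "((\<lambda>v. 1 - m\<^sup>2 * (sin (A v))\<^sup>2) has_real_derivative
            - (m\<^sup>2 * (2 * sin (A v) * (cos (A v) * D v)))) (at v)"
      by (auto intro!: derivative_eq_intros A')
    from DERIV_chain2[OF DERIV_real_sqrt[OF pos] this]
    have "(D has_real_derivative
            inverse (sqrt (1 - m\<^sup>2 * (sin (A v))\<^sup>2)) / 2 *
            (- (m\<^sup>2 * (2 * sin (A v) * (cos (A v) * D v))))) (at v)"
      by (simp add: D_def[abs_def])
    also have "inverse (sqrt (1 - m\<^sup>2 * (sin (A v))\<^sup>2)) / 2 *
            (- (m\<^sup>2 * (2 * sin (A v) * (cos (A v) * D v)))) = - m\<^sup>2 * sin (A v) * cos (A v)"
      unfolding D_def[symmetric] using D_pos[of v] by (simp add: field_simps)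
    finally show ?thesis .
  qed
  show thesis
  proof (rule that)
    fix v
    show "((\<lambda>v. (jacobi_cn v m)\<^sup>2) has_real_derivative - 2 * sin (A v) * cos (A v) * D v) (at v)"
      unfolding cn by (auto intro!: derivative_eq_intros A')
    have "((\<lambda>v. - 2 * sin (A v) * cos (A v) * D v) has_real_derivative
            - 2 * (cos (A v))\<^sup>2 * (D v)\<^sup>2 + 2 * (sin (A v))\<^sup>2 * (D v)\<^sup>2
            + 2 * m\<^sup>2 * (sin (A v))\<^sup>2 * (cos (A v))\<^sup>2) (at v)"
      by (auto intro!: derivative_eq_intros A' D' simp: algebra_simps power2_eq_square)
    then show "((\<lambda>v. - 2 * sin (A v) * cos (A v) * D v) has_real_derivative
        2 * (1 - m\<^sup>2 + 2 * (2 * m\<^sup>2 - 1) * (jacobi_cn v m)\<^sup>2 - 3 * m\<^sup>2 * ((jacobi_cn v m)\<^sup>2)\<^sup>2)) (at v)"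
      unfolding cn by (rule DERIV_cong) (use D_sq[of v] sin_cos_squared_add[of "A v"] in algebra)
  qed
qed

section \<open>Reduction to ordinary differential equations\<close>

lemma wave_derivatives:
  fixes f f' :: "real \<Rightarrow> real"
  assumes "\<And>\<xi>. (f has_real_derivative f' \<xi>) (at \<xi>)"
  shows "((\<lambda>y. f (y - \<sigma> * t)) has_real_derivative f' (x - \<sigma> * t)) (at x)"
    and "((\<lambda>s. f (x - \<sigma> * s)) has_real_derivative - \<sigma> * f' (x - \<sigma> * t)) (at t)"
proof -
  have "((\<lambda>y. y - \<sigma> * t) has_real_derivative 1) (at x)"
    by (auto intro!: derivative_eq_intros)
  from DERIV_chain2[OF assms this]
  show "((\<lambda>y. f (y - \<sigma> * t)) has_real_derivative f' (x - \<sigma> * t)) (at x)" by simp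
  have "((\<lambda>s. x - \<sigma> * s) has_real_derivative - \<sigma>) (at t)"
    by (auto intro!: derivative_eq_intros)
  from DERIV_chain2[OF assms this]
  show "((\<lambda>s. f (x - \<sigma> * s)) has_real_derivative - \<sigma> * f' (x - \<sigma> * t)) (at t)"
    by (simp add: mult.commute)
qed

lemma pdx_wave:
  assumes "\<And>\<xi>. (f has_real_derivative f' \<xi>) (at \<xi>)"
  shows "pdx (\<lambda>x t. f (x - \<sigma> * t)) = (\<lambda>x t. f' (x - \<sigma> * t))"
  unfolding pdx_def by (intro ext DERIV_imp_deriv wave_derivatives assms)

lemma pdt_wave:
  assumes "\<And>\<xi>. (f has_real_derivative f' \<xi>) (at \<xi>)"
  shows "pdt (\<lambda>x t. f (x - \<sigma> * t)) = (\<lambda>x t. - \<sigma> * f' (x - \<sigma> * t))"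
  unfolding pdt_def by (intro ext DERIV_imp_deriv wave_derivatives assms)

text \<open>Here \<open>h k\<close> is the \<open>k\<close>-th derivative of \<open>h 0\<close>. The
  factor \<open>K\<close> and the index \<open>j\<close> are general for the sake of the induction:
  \<open>pdx\<close> raises \<open>j\<close>, and \<open>pdt\<close> also multiplies
  \<open>K\<close> by \<open>-\<sigma>\<close>.\<close>

lemma C_class_wave:
  fixes h :: "nat \<Rightarrow> real \<Rightarrow> real"
  assumes "\<And>k \<xi>. k \<le> N \<Longrightarrow> (h k has_real_derivative h (Suc k) \<xi>) (at \<xi>)" and "j + n \<le> N"
  shows "C_class n (\<lambda>x t. K * h j (x - \<sigma> * t))"
  using assms(2)
proof (induction n arbitrary: j K)
  case (0 j K)
  have "continuous_on UNIV (h j)"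
    using assms(1)[of j] 0 by (auto intro!: DERIV_continuous_on)
  then show ?case
    by (auto intro!: continuous_intros continuous_on_compose2[of UNIV "h j"])
next
  case (Suc n j K)
  have h: "((\<lambda>\<xi>. K * h j \<xi>) has_real_derivative K * h (Suc j) \<xi>) (at \<xi>)" for \<xi> K
    using assms(1)[of j] Suc.prems by (auto intro!: derivative_eq_intros)
  have "continuous_on UNIV (h j)"
    using assms(1)[of j] Suc.prems by (auto intro!: DERIV_continuous_on)
  then have "continuous_on UNIV (\<lambda>p. K * h j (fst p - \<sigma> * snd p))"
    by (auto intro!: continuous_intros continuous_on_compose2[of UNIV "h j"])
  moreover have "(\<lambda>y. K * h j (y - \<sigma> * t)) differentiable at x"
    and "(\<lambda>s. K * h j (x - \<sigma> * s)) differentiable at t" for x t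
    using wave_derivatives[OF h] unfolding real_differentiable_def by blast+
  moreover have "C_class n (pdx (\<lambda>x t. K * h j (x - \<sigma> * t)))"
    unfolding pdx_wave[OF h] using Suc.IH[of "Suc j"] Suc.prems by simp
  moreover have "C_class n (pdt (\<lambda>x t. K * h j (x - \<sigma> * t)))"
    unfolding pdt_wave[OF h] using Suc.IH[of "Suc j" "- \<sigma> * K"] Suc.prems by (simp add: mult.assoc)
  ultimately show ?case by simp
qed

text \<open>The fourth derivative is there to make the third one continuous.\<close>

lemma C_class_3_wave:
  fixes f f1 f2 f3 f4 :: "real \<Rightarrow> real"
  assumes "\<And>\<xi>. (f has_real_derivative f1 \<xi>) (at \<xi>)"
    and "\<And>\<xi>. (f1 has_real_derivative f2 \<xi>) (at \<xi>)"
    and "\<And>\<xi>. (f2 has_real_derivative f3 \<xi>) (at \<xi>)"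
    and "\<And>\<xi>. (f3 has_real_derivative f4 \<xi>) (at \<xi>)"
  shows "C_class 3 (\<lambda>x t. f (x - \<sigma> * t))"
proof -
  define h where "h k = [f, f1, f2, f3, f4] ! k" for k
  have "(h k has_real_derivative h (Suc k) \<xi>) (at \<xi>)" if "k \<le> 3" for k \<xi>
  proof -
    from that have "k = 0 \<or> k = 1 \<or> k = 2 \<or> k = 3" by auto
    then show ?thesis using assms by (auto simp: h_def numeral_eq_Suc)
  qed
  then have "C_class 3 (\<lambda>x t. 1 * h 0 (x - \<sigma> * t))"
    by (rule C_class_wave) auto
  then show ?thesis by (simp add: h_def)
qed

text \<open>On functions of \<open>\<xi>\<close> the operators \<open>pdx\<close> and
  \<open>pdt\<close> act as \<open>d/d\<xi>\<close> and \<open>-\<sigma> d/d\<xi>\<close>. The mixed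
  terms with \<open>b\<close> and \<open>d\<close> thereby change sign in the two ordinary
  differential equations.\<close>

lemma traveling_wave_solutionI:
  fixes f f1 f2 f3 f4 g g1 g2 g3 g4 :: "real \<Rightarrow> real"
  assumes f: "\<And>\<xi>. (f has_real_derivative f1 \<xi>) (at \<xi>)"
      "\<And>\<xi>. (f1 has_real_derivative f2 \<xi>) (at \<xi>)"
      "\<And>\<xi>. (f2 has_real_derivative f3 \<xi>) (at \<xi>)"
      "\<And>\<xi>. (f3 has_real_derivative f4 \<xi>) (at \<xi>)"
    and g: "\<And>\<xi>. (g has_real_derivative g1 \<xi>) (at \<xi>)"
      "\<And>\<xi>. (g1 has_real_derivative g2 \<xi>) (at \<xi>)"
      "\<And>\<xi>. (g2 has_real_derivative g3 \<xi>) (at \<xi>)"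
      "\<And>\<xi>. (g3 has_real_derivative g4 \<xi>) (at \<xi>)"
    and ode1: "\<And>\<xi>. - \<sigma> * f1 \<xi> + g1 \<xi> + (g1 \<xi> * f \<xi> + g \<xi> * f1 \<xi>) + a * g3 \<xi> + b * \<sigma> * f3 \<xi> = 0"
    and ode2: "\<And>\<xi>. - \<sigma> * g1 \<xi> + f1 \<xi> + g \<xi> * g1 \<xi> + c * f3 \<xi> + d * \<sigma> * g3 \<xi> = 0"
  shows "traveling_wave_solution a b c d \<sigma> (\<lambda>x t. f (x - \<sigma> * t)) (\<lambda>x t. g (x - \<sigma> * t))"
proof -
  have gf: "((\<lambda>\<xi>. g \<xi> * f \<xi>) has_real_derivative g1 \<xi> * f \<xi> + g \<xi> * f1 \<xi>) (at \<xi>)" for \<xi>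
    by (auto intro!: derivative_eq_intros f g)
  note pd = pdx_wave[OF f(1)] pdx_wave[OF f(2)] pdx_wave[OF f(3)] pdt_wave[OF f(1)] pdt_wave[OF f(3)]
    pdx_wave[OF g(1)] pdx_wave[OF g(2)] pdx_wave[OF g(3)] pdt_wave[OF g(1)] pdt_wave[OF g(3)]
    pdx_wave[OF gf]
  have "abcd_solution a b c d (\<lambda>x t. f (x - \<sigma> * t)) (\<lambda>x t. g (x - \<sigma> * t))"
    unfolding abcd_solution_def pd
  proof (intro conjI allI)
    fix x t
    let ?\<xi> = "x - \<sigma> * t"
    show "- \<sigma> * f1 ?\<xi> + g1 ?\<xi> + (g1 ?\<xi> * f ?\<xi> + g ?\<xi> * f1 ?\<xi>) + a * g3 ?\<xi>
            - b * (- \<sigma> * f3 ?\<xi>) = 0"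
      using ode1[of ?\<xi>] by simp
    show "- \<sigma> * g1 ?\<xi> + f1 ?\<xi> + g ?\<xi> * g1 ?\<xi> + c * f3 ?\<xi> - d * (- \<sigma> * g3 ?\<xi>) = 0"
      using ode2[of ?\<xi>] by simp
  qed (rule C_class_3_wave[OF f] C_class_3_wave[OF g])+
  then show ?thesis unfolding traveling_wave_solution_def by blast
qed

section \<open>Algebraic equations for the coefficients\<close>

text \<open>In each equation \<open>u0\<close>, \<open>v0\<close> cancel the coefficient of
  \<open>u'\<close>, and \<open>u1\<close>, \<open>v1\<close> that of \<open>u u'\<close>. The
  constants 6 and 12 differ because \<open>(w \<eta>)'\<close> contributes
  \<open>2 j2 k2 u u'\<close>, whereas \<open>w w'\<close> contributes
  \<open>k2\<^sup>2 u u'\<close>.\<close>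

lemma cn_square_traveling_wave:
  assumes m: "0 < m" "m \<le> 1"
    and u0: "- \<sigma> * j2 + k2 + k0 * j2 + j0 * k2 + 4 * l\<^sup>2 * (2 * m\<^sup>2 - 1) * (a * k2 + b * \<sigma> * j2) = 0"
    and u1: "j2 * k2 = 6 * l\<^sup>2 * m\<^sup>2 * (a * k2 + b * \<sigma> * j2)"
    and v0: "- \<sigma> * k2 + j2 + k0 * k2 + 4 * l\<^sup>2 * (2 * m\<^sup>2 - 1) * (c * j2 + d * \<sigma> * k2) = 0"
    and v1: "k2\<^sup>2 = 12 * l\<^sup>2 * m\<^sup>2 * (c * j2 + d * \<sigma> * k2)"
  shows "traveling_wave_solution a b c d \<sigma>
           (\<lambda>x t. j0 + j2 * (jacobi_cn (l * (x - \<sigma> * t)) m)\<^sup>2)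
           (\<lambda>x t. k0 + k2 * (jacobi_cn (l * (x - \<sigma> * t)) m)\<^sup>2)"
proof -
  obtain p where
    p: "\<And>v. ((\<lambda>v. (jacobi_cn v m)\<^sup>2) has_real_derivative p v) (at v)" and
    p': "\<And>v. (p has_real_derivative
        2 * (1 - m\<^sup>2 + 2 * (2 * m\<^sup>2 - 1) * (jacobi_cn v m)\<^sup>2 - 3 * m\<^sup>2 * ((jacobi_cn v m)\<^sup>2)\<^sup>2)) (at v)"
    using jacobi_cn_square_derivatives[OF m] by blast
  define u where "u \<xi> = (jacobi_cn (l * \<xi>) m)\<^sup>2" for \<xi>
  define u1 where "u1 \<xi> = l * p (l * \<xi>)" for \<xi>
  define u2 where "u2 \<xi> = 2 * l\<^sup>2 * (1 - m\<^sup>2 + 2 * (2 * m\<^sup>2 - 1) * u \<xi> - 3 * m\<^sup>2 * (u \<xi>)\<^sup>2)" for \<xi>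
  define u3 where "u3 \<xi> = 4 * l\<^sup>2 * (2 * m\<^sup>2 - 1 - 3 * m\<^sup>2 * u \<xi>) * u1 \<xi>" for \<xi>
  define u4 where "u4 \<xi> = 4 * l\<^sup>2 * ((2 * m\<^sup>2 - 1 - 3 * m\<^sup>2 * u \<xi>) * u2 \<xi> - 3 * m\<^sup>2 * (u1 \<xi>)\<^sup>2)" for \<xi>
  have lin: "((\<lambda>\<xi>. l * \<xi>) has_real_derivative l) (at \<xi>)" for \<xi>
    by (auto intro!: derivative_eq_intros)
  have d1: "(u has_real_derivative u1 \<xi>) (at \<xi>)" for \<xi>
    using DERIV_chain2[OF p lin, of \<xi>] by (simp add: u_def[abs_def] u1_def mult.commute)
  have d2: "(u1 has_real_derivative u2 \<xi>) (at \<xi>)" for \<xi>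
    using DERIV_cmult[OF DERIV_chain2[OF p' lin, of \<xi>], of l]
    by (simp add: u_def[abs_def] u1_def[abs_def] u2_def algebra_simps power2_eq_square)
  have d3: "(u2 has_real_derivative u3 \<xi>) (at \<xi>)" for \<xi>
    unfolding u2_def[abs_def] u3_def
    by (auto intro!: derivative_eq_intros d1 simp: algebra_simps)
  have d4: "(u3 has_real_derivative u4 \<xi>) (at \<xi>)" for \<xi>
    unfolding u3_def[abs_def] u4_def
    by (auto intro!: derivative_eq_intros d1 d2 simp: algebra_simps power2_eq_square)
  have aff: "((\<lambda>\<xi>. \<alpha> + \<beta> * u \<xi>) has_real_derivative \<beta> * u1 \<xi>) (at \<xi>)" for \<alpha> \<beta> \<xi>
    by (auto intro!: derivative_eq_intros d1)
  have "traveling_wave_solution a b c d \<sigma>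
           (\<lambda>x t. j0 + j2 * u (x - \<sigma> * t)) (\<lambda>x t. k0 + k2 * u (x - \<sigma> * t))"
  proof (rule traveling_wave_solutionI[OF aff d2[THEN DERIV_cmult] d3[THEN DERIV_cmult] d4[THEN DERIV_cmult]
        aff d2[THEN DERIV_cmult] d3[THEN DERIV_cmult] d4[THEN DERIV_cmult]])
    fix \<xi>
    have "- \<sigma> * (j2 * u1 \<xi>) + k2 * u1 \<xi> + (k2 * u1 \<xi> * (j0 + j2 * u \<xi>) + (k0 + k2 * u \<xi>) * (j2 * u1 \<xi>))
            + a * (k2 * u3 \<xi>) + b * \<sigma> * (j2 * u3 \<xi>)
        = ((- \<sigma> * j2 + k2 + k0 * j2 + j0 * k2 + 4 * l\<^sup>2 * (2 * m\<^sup>2 - 1) * (a * k2 + b * \<sigma> * j2))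
            + 2 * (j2 * k2 - 6 * l\<^sup>2 * m\<^sup>2 * (a * k2 + b * \<sigma> * j2)) * u \<xi>) * u1 \<xi>"
      unfolding u3_def by algebra
    then show "- \<sigma> * (j2 * u1 \<xi>) + k2 * u1 \<xi> + (k2 * u1 \<xi> * (j0 + j2 * u \<xi>) + (k0 + k2 * u \<xi>) * (j2 * u1 \<xi>))
            + a * (k2 * u3 \<xi>) + b * \<sigma> * (j2 * u3 \<xi>) = 0"
      unfolding u0 u1 by simp
    have "- \<sigma> * (k2 * u1 \<xi>) + j2 * u1 \<xi> + (k0 + k2 * u \<xi>) * (k2 * u1 \<xi>)
            + c * (j2 * u3 \<xi>) + d * \<sigma> * (k2 * u3 \<xi>)
        = ((- \<sigma> * k2 + j2 + k0 * k2 + 4 * l\<^sup>2 * (2 * m\<^sup>2 - 1) * (c * j2 + d * \<sigma> * k2))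
            + (k2\<^sup>2 - 12 * l\<^sup>2 * m\<^sup>2 * (c * j2 + d * \<sigma> * k2)) * u \<xi>) * u1 \<xi>"
      unfolding u3_def by algebra
    then show "- \<sigma> * (k2 * u1 \<xi>) + j2 * u1 \<xi> + (k0 + k2 * u \<xi>) * (k2 * u1 \<xi>)
            + c * (j2 * u3 \<xi>) + d * \<sigma> * (k2 * u3 \<xi>) = 0"
      unfolding v0 v1 by simp
  qed
  then show ?thesis by (simp add: u_def)
qed

theorem mainTheorem4:
  fixes a b c d l \<sigma> m \<epsilon> S j0 j1 j2 k0 k1 k2 :: real
    and \<eta> w :: "real \<Rightarrow> real \<Rightarrow> real"
  assumes "admissible a b c d"
    and "c \<noteq> 0"
    and "l > 0"
    and "\<sigma> \<noteq> 0"
    and "m \<in> {0<..1}"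
    and "\<epsilon> \<in> {1, -1}"
    and "8*a*c + \<sigma>^2*(b - 2*d)^2 > 0"
    and "S = sqrt (8*a*c + \<sigma>^2*(b - 2*d)^2)"
    and "j1 = 0"
    and "k1 = 0"
    and "j2 = 3*l^2*m^2 / (2*c) * (4*a*c + b*\<sigma>^2*(b - 2*d) + \<epsilon>*b*\<sigma>*S)"
    and "k2 = 3*l^2*m^2 * (\<sigma>*(b + 2*d) + \<epsilon>*S)"
    and "k0 = 1 / (2*c*(\<sigma>*(b + 2*d) + \<epsilon>*S)) *
           (- 8*b^2*c*l^2*m^2*\<sigma>^2 - 32*c*d^2*l^2*m^2*\<sigma>^2 - 32*a*c^2*l^2*m^2
            + 4*b^2*c*l^2*\<sigma>^2 + 16*c*d^2*l^2*\<sigma>^2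
            + 16*a*l^2*c^2 - b^2*\<sigma>^2 + 2*b*c*\<sigma>^2 + 2*b*d*\<sigma>^2 + 4*c*d*\<sigma>^2 - 4*a*c
            - \<epsilon>*\<sigma>*S*(8*b*c*l^2*m^2 + 16*c*d*l^2*m^2 - 4*b*c*l^2 - 8*c*d*l^2 + b - 2*c))"
    and "j0 = 1 / (4*c^2*(4*a*c + \<sigma>^2*(b^2 + 4*d^2) + \<epsilon>*\<sigma>*(b + 2*d)*S)) *
           (- 8*b^4*c*l^2*m^2*\<sigma>^4 + 16*b^3*c*d*l^2*m^2*\<sigma>^4
            - 64*a*b^2*c^2*l^2*m^2*\<sigma>^2 - 32*a*b*c^2*d*l^2*m^2*\<sigma>^2
            - 64*a*c^2*d^2*l^2*m^2*\<sigma>^2 + 4*b^4*c*l^2*\<sigma>^4 - 8*b^3*c*d*l^2*\<sigma>^4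
            - 64*a^2*c^3*l^2*m^2 + 32*a*b^2*c^2*l^2*\<sigma>^2
            + 16*a*b*c^2*d*l^2*\<sigma>^2 + 32*a*c^2*d^2*l^2*\<sigma>^2
            + b^4*\<sigma>^4 - 4*b^3*d*\<sigma>^4 + 4*b^2*d^2*\<sigma>^4 + 32*a^2*c^3*l^2
            + 8*a*b^2*c*\<sigma>^2 - 8*a*b*c*d*\<sigma>^2 - 4*b^2*c^2*\<sigma>^2 - 16*c^2*d^2*\<sigma>^2
            + 8*a^2*c^2 - 16*a*c^3
            - \<epsilon>*\<sigma>*S*(8*b^3*c*l^2*m^2*\<sigma>^2 + 32*a*b*c^2*l^2*m^2 + 32*a*c^2*d*l^2*m^2
                   - 4*b^3*c*l^2*\<sigma>^2 - 16*a*b*c^2*l^2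
                   - 16*a*c^2*d*l^2 - b^3*\<sigma>^2 + 2*b^2*d*\<sigma>^2 - 4*a*b*c + 4*b*c^2 + 8*c^2*d))"
    and "\<eta> = (\<lambda>x t. j0 + j1 * jacobi_cn (l * (x - \<sigma>*t)) m + j2 * (jacobi_cn (l * (x - \<sigma>*t)) m)^2)"
    and "w = (\<lambda>x t. k0 + k1 * jacobi_cn (l * (x - \<sigma>*t)) m + k2 * (jacobi_cn (l * (x - \<sigma>*t)) m)^2)"
  shows "traveling_wave_solution a b c d \<sigma> \<eta> w"
proof -
  have m: "0 < m" "m \<le> 1" using assms(5) by auto
  \<comment> \<open>Only \<open>T\<^sup>2\<close> and linear relations in \<open>T\<close> enter, so
    both signs of \<open>\<epsilon>\<close> are treated at once.\<close>
  define T where "T = \<epsilon> * S"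
  have "\<epsilon>\<^sup>2 = 1" using assms(6) by auto
  then have T_sq: "T\<^sup>2 = 8*a*c + \<sigma>\<^sup>2*(b - 2*d)\<^sup>2"
    using assms(7,8) by (simp add: T_def power_mult_distrib)
  define p where "p = \<sigma>*(b + 2*d) + T"
  \<comment> \<open>For \<open>k2 \<noteq> 0\<close> and \<open>q = j2 / k2\<close>, the condition
    \<open>v1\<close> reads \<open>p = 4*(c*q + d*\<sigma>)\<close>; this is its solution for
    \<open>q\<close>.\<close>
  define q where "q = (p - 4*d*\<sigma>) / (4*c)"
  have T: "T = p - \<sigma>*(b + 2*d)" by (simp add: p_def)
  have a: "8*(a*c) = p\<^sup>2 - 2*p*\<sigma>*(b + 2*d) + 8*b*d*\<sigma>\<^sup>2"
    using T_sq unfolding T by algebra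
  have q: "4*c*q = p - 4*d*\<sigma>" using assms(2) by (simp add: q_def)
  have k2: "k2 = 3*l\<^sup>2*m\<^sup>2 * p"
    unfolding assms(12) p_def T_def ..
  have j2: "j2 = 3*l\<^sup>2*m\<^sup>2 * (p*q)"
  proof -
    \<comment> \<open>The terms with \<open>b\<close> on the left sum to
      \<open>b*\<sigma>*(p - 4*d*\<sigma>) = 4*b*c*q*\<sigma>\<close>, and
      \<open>4*a*c = 2*c*q*(p - 2*b*\<sigma>)\<close>.\<close>
    have "4*a*c + b*\<sigma>\<^sup>2*(b - 2*d) + \<epsilon>*b*\<sigma>*S = 2*c*(p*q)"
      using a q T[unfolded T_def] by algebra
    then show ?thesis
      unfolding assms(11) using assms(2) by simp
  qed
  have a2: "2*a = p*q - 2*b*\<sigma>*q"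
  proof -
    \<comment> \<open>The right side of \<open>a\<close> factors as
      \<open>(p - 4*d*\<sigma>)*(p - 2*b*\<sigma>)\<close>, whose first factor is
      \<open>4*c*q\<close>; then \<open>c\<close> cancels.\<close>
    have "4*c*(p*q - 2*b*\<sigma>*q) = 4*c*(2*a)"
      using a q by algebra
    then show ?thesis using assms(2) by simp
  qed
  \<comment> \<open>Together with \<open>a2\<close> and the formula for
    \<open>2*(\<epsilon>*S)\<close> below, this eliminates \<open>a\<close>,
    \<open>d*\<sigma>\<close> and \<open>\<epsilon>*S\<close> from the long expressions, in which
    \<open>d\<close> always comes with a factor \<open>\<sigma>\<close>.\<close>
  have ds: "4*(d*\<sigma>) = p - 4*c*q" using q by simp
  have u1: "j2 * k2 = 6 * l\<^sup>2 * m\<^sup>2 * (a * k2 + b * \<sigma> * j2)"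
    unfolding j2 k2 using a2 by algebra
  have v1: "k2\<^sup>2 = 12 * l\<^sup>2 * m\<^sup>2 * (c * j2 + d * \<sigma> * k2)"
    unfolding j2 k2 using q by algebra
  have uv0: "- \<sigma> * j2 + k2 + k0 * j2 + j0 * k2 + 4 * l\<^sup>2 * (2 * m\<^sup>2 - 1) * (a * k2 + b * \<sigma> * j2) = 0
     \<and> - \<sigma> * k2 + j2 + k0 * k2 + 4 * l\<^sup>2 * (2 * m\<^sup>2 - 1) * (c * j2 + d * \<sigma> * k2) = 0"
  proof (cases "p = 0")
    case True
    then show ?thesis by (simp add: j2 k2)
  next
    case False
    have T: "2*(\<epsilon>*S) = p + 4*c*q - 2*(b*\<sigma>)"
      using T ds unfolding T_def by algebra
    \<comment> \<open>The last factor on the right is the value of \<open>k0\<close> obtained by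
      dividing the second condition of \<open>uv0\<close> by \<open>k2\<close> and using
      \<open>4*(c*q + d*\<sigma>) = p\<close>.\<close>
    have "(- 8*b^2*c*l^2*m^2*\<sigma>^2 - 32*c*d^2*l^2*m^2*\<sigma>^2 - 32*a*c^2*l^2*m^2
            + 4*b^2*c*l^2*\<sigma>^2 + 16*c*d^2*l^2*\<sigma>^2
            + 16*a*l^2*c^2 - b^2*\<sigma>^2 + 2*b*c*\<sigma>^2 + 2*b*d*\<sigma>^2 + 4*c*d*\<sigma>^2 - 4*a*c
            - \<epsilon>*\<sigma>*S*(8*b*c*l^2*m^2 + 16*c*d*l^2*m^2 - 4*b*c*l^2 - 8*c*d*l^2 + b - 2*c)) = 2*c*p * (\<sigma> - q - l\<^sup>2 * (2 * m\<^sup>2 - 1) * p)"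
      using a2 ds T by algebra
    moreover have "\<sigma>*(b + 2*d) + \<epsilon>*S = p" by (simp add: p_def T_def)
    ultimately have k0: "k0 = \<sigma> - q - l\<^sup>2 * (2 * m\<^sup>2 - 1) * p"
      unfolding assms(13) using False assms(2) by simp
    \<comment> \<open>Likewise the first condition of \<open>uv0\<close>, divided by
      \<open>k2\<close>, gives \<open>j0\<close> by means of
      \<open>2*(a + b*\<sigma>*q) = p*q\<close> and the value of \<open>k0\<close>.\<close>
    have "(- 8*b^4*c*l^2*m^2*\<sigma>^4 + 16*b^3*c*d*l^2*m^2*\<sigma>^4
            - 64*a*b^2*c^2*l^2*m^2*\<sigma>^2 - 32*a*b*c^2*d*l^2*m^2*\<sigma>^2
            - 64*a*c^2*d^2*l^2*m^2*\<sigma>^2 + 4*b^4*c*l^2*\<sigma>^4 - 8*b^3*c*d*l^2*\<sigma>^4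
            - 64*a^2*c^3*l^2*m^2 + 32*a*b^2*c^2*l^2*\<sigma>^2
            + 16*a*b*c^2*d*l^2*\<sigma>^2 + 32*a*c^2*d^2*l^2*\<sigma>^2
            + b^4*\<sigma>^4 - 4*b^3*d*\<sigma>^4 + 4*b^2*d^2*\<sigma>^4 + 32*a^2*c^3*l^2
            + 8*a*b^2*c*\<sigma>^2 - 8*a*b*c*d*\<sigma>^2 - 4*b^2*c^2*\<sigma>^2 - 16*c^2*d^2*\<sigma>^2
            + 8*a^2*c^2 - 16*a*c^3
            - \<epsilon>*\<sigma>*S*(8*b^3*c*l^2*m^2*\<sigma>^2 + 32*a*b*c^2*l^2*m^2 + 32*a*c^2*d*l^2*m^2
                   - 4*b^3*c*l^2*\<sigma>^2 - 16*a*b*c^2*l^2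
                   - 16*a*c^2*d*l^2 - b^3*\<sigma>^2 + 2*b^2*d*\<sigma>^2 - 4*a*b*c + 4*b*c^2 + 8*c^2*d))
          = 2*c\<^sup>2*p\<^sup>2 * (q\<^sup>2 - 1 - l\<^sup>2 * (2 * m\<^sup>2 - 1) * (p * q))"
      using a2 ds T by algebra
    \<comment> \<open>The bracket is \<open>p\<^sup>2 / 2\<close>: in \<open>p\<^sup>2\<close> the
      products \<open>b*d\<close> from \<open>(b + 2*d)\<^sup>2\<close> and from
      \<open>T\<^sup>2\<close> cancel.\<close>
    moreover have "4*c^2*(4*a*c + \<sigma>^2*(b^2 + 4*d^2) + \<epsilon>*\<sigma>*(b + 2*d)*S) = 2*c\<^sup>2*p\<^sup>2"
      using a2 ds T by algebra
    ultimately have j0: "j0 = q\<^sup>2 - 1 - l\<^sup>2 * (2 * m\<^sup>2 - 1) * (p * q)"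
      unfolding assms(14) using False assms(2) by simp
    show ?thesis
      unfolding k0 j0 k2 j2 using a2 ds by (intro conjI) algebra+
  qed
  have "traveling_wave_solution a b c d \<sigma>
           (\<lambda>x t. j0 + j2 * (jacobi_cn (l * (x - \<sigma> * t)) m)\<^sup>2)
           (\<lambda>x t. k0 + k2 * (jacobi_cn (l * (x - \<sigma> * t)) m)\<^sup>2)"
    using cn_square_traveling_wave[OF m _ u1 _ v1] uv0 by blast
  then show ?thesis
    unfolding assms(15,16) using assms(9,10) by simp
qed

end
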